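(* Let $U$ be a subset of $F_{USCG}(\mathbb{R}^m)$. Then $U$ is a compact set in $(F_{USCG}(\mathbb{R}^m),H_{\rm end})$ if and only if $U$ is a closed set in $(F_{USCG}(\mathbb{R}^m),H_{\rm end})$ and $U(\alpha):=\bigcup_{u\in U}[u]_\alpha$ is a bounded set in $\mathbb{R}^m$ for each $\alpha\in(0,1]$.
   Context: A fuzzy set on $\mathbb{R}^m$ is a function $u:\mathbb{R}^m\to[0,1]$. For $\alpha\in(0,1]$, $[u]_\alpha=\{x:u(x)\ge\alpha\}$. $F_{USCG}(\mathbb{R}^m)$ is the set of all upper semi-continuous fuzzy sets $u$ on $\mathbb{R}^m$ with $[u]_\alpha$ bounded for each $\alpha\in(0,1]$ (cuts may be empty). The endograph of $u$ is ${\rm end}\,u=\{(x,t)\in\mathbb{R}^m\times[0,1]:u(x)\ge t\}$, and the endograph metric is $H_{\rm end}(u,v)=H({\rm end}\,u,{\rm end}\,v)$, where $H(A,B)=\max\{\sup_{a\in A}\inf_{b\in B}d(a,b),\ \sup_{b\in B}\inf_{a\in A}d(a,b)\}$ is the Hausdorff metric on nonempty closed sets ($d$ Euclidean). *)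

theory Defs
  imports "HOL-Analysis.Analysis"
begin

typedef 'a fuzzy_set = "{u :: 'a \<Rightarrow> real. \<forall>x. 0 \<le> u x \<and> u x \<le> 1}"
  morphisms membership Fuzzy
  by (rule exI[of _ "\<lambda>_. 0"]) simp

definition alpha_cut :: "'a fuzzy_set \<Rightarrow> real \<Rightarrow> 'a set" where
  "alpha_cut u \<alpha> = {x. membership u x \<ge> \<alpha>}"

definition upper_semicontinuous :: "('a::topological_space \<Rightarrow> real) \<Rightarrow> bool" where
  "upper_semicontinuous f \<longleftrightarrow> (\<forall>x. \<forall>r > f x. \<forall>\<^sub>F y in nhds x. f y < r)"

definition F_USCG :: "(real ^ 'm) fuzzy_set set" where
  "F_USCG = {u. upper_semicontinuous (membership u) \<and> (\<forall>\<alpha>\<in>{0<..1}. bounded (alpha_cut u \<alpha>))}"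

definition endograph :: "'a fuzzy_set \<Rightarrow> ('a \<times> real) set" where
  "endograph u = {(x, t). 0 \<le> t \<and> t \<le> 1 \<and> membership u x \<ge> t}"

(* The suprema and infima are real-valued, so this is the Hausdorff distance only for nonempty
   sets whose excess over one another is finite. Endographs qualify: each contains all (x, 0),
   so the excess is at most 1 (see endograph_excess below). *)
definition Hausdorff_dist :: "'a::metric_space set \<Rightarrow> 'a set \<Rightarrow> real" where
  "Hausdorff_dist A B =
     max (SUP a\<in>A. INF b\<in>B. dist a b) (SUP b\<in>B. INF a\<in>A. dist a b)"

(* The distance of the product type is the Euclidean (l2) product distance. *)
definition H_end :: "'a::metric_space fuzzy_set \<Rightarrow> 'a fuzzy_set \<Rightarrow> real" where
  "H_end u v = Hausdorff_dist (endograph u) (endograph v)"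

lemma membership_bounds: "0 \<le> membership u x" "membership u x \<le> 1"
  using membership[of u] by auto

lemma zero_in_endograph: "(x, 0) \<in> endograph u"
  by (simp add: endograph_def membership_bounds)

lemma endograph_nonempty: "endograph u \<noteq> {}"
  using zero_in_endograph[of undefined u] by auto

lemma endograph_excess:
  fixes u v :: "'a::metric_space fuzzy_set"
  assumes "a \<in> endograph u"
  shows "infdist a (endograph v) \<le> 1"
proof -
  obtain x t where a: "a = (x, t)" "0 \<le> t" "t \<le> 1"
    using assms by (auto simp: endograph_def)
  have "dist a (x, 0) \<le> 1"
    using a by (simp add: dist_Pair_Pair)
  then show ?thesis
    by (rule infdist_le2[OF zero_in_endograph])
qed

lemma bdd_above_excess: "bdd_above ((\<lambda>a. infdist a (endograph v)) ` endograph u)"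
  by (intro bdd_aboveI[of _ 1]) (auto intro: endograph_excess)

lemma H_end_infdist:
  "H_end u v = max (SUP a\<in>endograph u. infdist a (endograph v))
                   (SUP b\<in>endograph v. infdist b (endograph u))"
  unfolding H_end_def Hausdorff_dist_def
  by (simp add: infdist_notempty endograph_nonempty dist_commute)

lemma infdist_le_H_end:
  assumes "a \<in> endograph u"
  shows "infdist a (endograph v) \<le> H_end u v"
  unfolding H_end_infdist
  using cSUP_upper[OF assms bdd_above_excess[of v u]] by linarith

lemma H_end_commute: "H_end u v = H_end v u"
  by (simp add: H_end_infdist max.commute)

lemma H_end_nonneg: "0 \<le> H_end u v"
  by (rule order_trans[OF infdist_nonneg infdist_le_H_end[OF zero_in_endograph[of undefined u]]])

lemma H_end_leI:
  assumes "\<And>a. a \<in> endograph u \<Longrightarrow> infdist a (endograph v) \<le> r"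
    and "\<And>b. b \<in> endograph v \<Longrightarrow> infdist b (endograph u) \<le> r"
  shows "H_end u v \<le> r"
  unfolding H_end_infdist
  by (intro max.boundedI cSUP_least endograph_nonempty assms)

lemma infdist_endograph_triangle:
  assumes "a \<in> endograph u"
  shows "infdist a (endograph w) \<le> H_end u v + H_end v w"
proof -
  have "infdist a (endograph w) - H_end v w \<le> dist a b" if "b \<in> endograph v" for b
    using infdist_le_H_end[OF that, of w] infdist_triangle[of a "endograph w" b] by linarith
  then have "infdist a (endograph w) - H_end v w \<le> infdist a (endograph v)"
    unfolding infdist_notempty[OF endograph_nonempty[of v]]
    by (intro cINF_greatest endograph_nonempty) auto
  then show ?thesis
    using infdist_le_H_end[OF assms, of v] by linarith
qed

lemma H_end_triangle: "H_end u w \<le> H_end u v + H_end v w"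
proof (rule H_end_leI)
  show "infdist b (endograph u) \<le> H_end u v + H_end v w" if "b \<in> endograph w" for b
    using infdist_endograph_triangle[OF that, of u v] by (simp add: H_end_commute)
qed (rule infdist_endograph_triangle)

lemma closed_endograph:
  fixes u :: "'a::metric_space fuzzy_set"
  assumes "upper_semicontinuous (membership u)"
  shows "closed (endograph u)"
  unfolding closed_def
proof (subst open_subopen, intro ballI)
  fix p assume p: "p \<in> - endograph u"
  obtain x t where xt: "p = (x, t)" by (cases p)
  consider "t < 0" | "t > 1" | "membership u x < t"
    using p xt by (auto simp: endograph_def not_le)
  then show "\<exists>T. open T \<and> p \<in> T \<and> T \<subseteq> - endograph u"
  proof cases
    case 1
    then show ?thesis
      by (intro exI[of _ "UNIV \<times> {..<0}"]) (auto simp: xt endograph_def intro: open_Times)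
  next
    case 2
    then show ?thesis
      by (intro exI[of _ "UNIV \<times> {1<..}"]) (auto simp: xt endograph_def intro: open_Times)
  next
    case 3
    then obtain r where r: "membership u x < r" "r < t"
      using dense by blast
    then have "\<forall>\<^sub>F y in nhds x. membership u y < r"
      using assms by (auto simp: upper_semicontinuous_def)
    then obtain S where S: "open S" "x \<in> S" "\<And>y. y \<in> S \<Longrightarrow> membership u y < r"
      by (auto simp: eventually_nhds)
    have "S \<times> {r<..} \<subseteq> - endograph u"
      using S(3) by (fastforce simp: endograph_def)
    then show ?thesis
      using r S(1,2) by (intro exI[of _ "S \<times> {r<..}"]) (auto simp: xt intro: open_Times)
  qed
qed

lemma endograph_inject:
  assumes "endograph u = endograph v"
  shows "u = v"
proof -
  have "membership u x \<le> membership v x" if "endograph u = endograph v" for u v :: "'a fuzzy_set" and x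
  proof -
    have "(x, membership u x) \<in> endograph u"
      by (simp add: endograph_def membership_bounds)
    then show ?thesis
      unfolding that by (simp add: endograph_def)
  qed
  then have "membership u = membership v"
    using assms by (intro ext antisym) auto
  then show ?thesis
    by (simp add: membership_inject)
qed

lemma H_end_eq_0_iff:
  assumes "u \<in> F_USCG" "v \<in> F_USCG"
  shows "H_end u v = 0 \<longleftrightarrow> u = v"
proof
  assume "H_end u v = 0"
  have "endograph u \<subseteq> endograph v" if "H_end u v = 0" "v \<in> F_USCG" for u v :: "(real ^ 'a) fuzzy_set"
  proof
    fix a assume "a \<in> endograph u"
    then have "infdist a (endograph v) = 0"
      using infdist_le_H_end[of a u v] infdist_nonneg[of a "endograph v"] that(1) by linarith
    moreover have "closed (endograph v)"
      using that(2) by (auto simp: F_USCG_def intro: closed_endograph)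
    ultimately show "a \<in> endograph v"
      by (simp add: in_closed_iff_infdist_zero endograph_nonempty)
  qed
  then show "u = v"
    using assms \<open>H_end u v = 0\<close> H_end_commute[of u v]
    by (intro endograph_inject antisym) simp_all
next
  assume "u = v"
  then have "H_end u v \<le> 0"
    by (intro H_end_leI) auto
  then show "H_end u v = 0"
    using H_end_nonneg[of u v] by linarith
qed

interpretation USCG: Metric_space F_USCG H_end
  by (rule Metric_space.intro) (fact H_end_nonneg H_end_commute H_end_eq_0_iff | rule H_end_triangle)+

end

theory Submission
  imports Defs
begin

text \<open>The theorem is an instance of the principle that, in a complete metric space, the compact
  sets are the closed totally bounded ones. Two facts about the endograph metric make it apply.

  \<^item> \<open>F_USCG\<close> is complete (\<open>mcomplete_F_USCG\<close>). A Cauchy sequence of endographs converges to the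
    set of points whose distance to the endographs tends to \<open>0\<close>, and this set is again the
    endograph of an upper semicontinuous fuzzy set. Bounded closed sets of the ambient space
    being compact, no point of the approximating endographs gets lost in the limit. The cuts of
    the limit are bounded because \<open>H_end u v < \<delta>\<close> places the \<open>\<alpha>\<close>-cut of \<open>u\<close> in the
    \<open>\<delta>\<close>-neighbourhood of the \<open>(\<alpha> - \<delta>)\<close>-cut of \<open>v\<close>.

  \<^item> A family \<open>U\<close> in \<open>F_USCG\<close> is totally bounded if and only if the union of its \<open>\<alpha>\<close>-cuts is
    bounded for every level \<open>\<alpha>\<close> (\<open>mtotally_bounded_iff_bounded_cuts\<close>). From left to right, all
    members of \<open>U\<close> lie within \<open>\<alpha> / 2\<close> of finitely many fuzzy sets, and the neighbourhood
    estimate above applies with \<open>\<delta> = \<alpha> / 2\<close>. From right to left, every endograph contains the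
    whole base plane at height \<open>0\<close>, so up to an error \<open>\<epsilon>\<close> only points of height more than
    \<open>\<epsilon>\<close> matter; these lie in a single bounded set, and recording which points of a finite
    \<open>\<epsilon>\<close>-net of it are close to the endograph determines the fuzzy set up to an error \<open>2 * \<epsilon>\<close>.\<close>

section \<open>Points and cuts of nearby endographs\<close>

lemma infdist_less_obtains:
  assumes "infdist x A < r" "A \<noteq> {}"
  obtains a where "a \<in> A" "dist x a < r"
proof -
  have "(INF a\<in>A. dist x a) < r"
    using assms by (simp add: infdist_notempty)
  then show thesis
    using assms(2) that by (subst (asm) cINF_less_iff) auto
qed

lemma endograph_near_point:
  assumes "a \<in> endograph u" "H_end u v < r"
  obtains b where "b \<in> endograph v" "dist a b < r"
  using infdist_less_obtains[OF _ endograph_nonempty] infdist_le_H_end[OF assms(1), of v] assms(2)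
  by (metis le_less_trans)

lemma alpha_cut_near_point:
  assumes "x \<in> alpha_cut u \<alpha>" "0 \<le> \<alpha>" "H_end u v < \<delta>"
  obtains y where "y \<in> alpha_cut v (\<alpha> - \<delta>)" "dist x y < \<delta>"
proof -
  have "(x, \<alpha>) \<in> endograph u"
    using assms membership_bounds(2)[of u x] by (simp add: alpha_cut_def endograph_def)
  then obtain b where b: "b \<in> endograph v" "dist (x, \<alpha>) b < \<delta>"
    using endograph_near_point assms(3) by blast
  have "dist x (fst b) < \<delta>" "dist \<alpha> (snd b) < \<delta>"
    using b(2) dist_fst_le[of "(x, \<alpha>)" b] dist_snd_le[of "(x, \<alpha>)" b] by auto
  moreover have "snd b \<le> membership v (fst b)"
    using b(1) by (auto simp: endograph_def)
  ultimately show thesis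
    by (intro that[of "fst b"]) (auto simp: alpha_cut_def dist_real_def)
qed

text \<open>Half of the level is spent on the distance to a member of the finite family, so that the
  remaining level \<open>\<alpha> / 2\<close> is still positive and the cuts there are bounded.\<close>

lemma bounded_cuts_of_finite_net:
  fixes U K :: "(real ^ 'm) fuzzy_set set"
  assumes "finite K" "K \<subseteq> F_USCG" "\<alpha> \<in> {0<..1}"
    and near: "\<And>u. u \<in> U \<Longrightarrow> \<exists>v\<in>K. H_end u v < \<alpha> / 2"
  shows "bounded (\<Union>u\<in>U. alpha_cut u \<alpha>)"
proof -
  have "bounded (\<Union>v\<in>K. alpha_cut v (\<alpha> / 2))"
    using assms(1-3) by (intro bounded_UN) (auto simp: F_USCG_def)
  then obtain R where R: "\<And>v y. v \<in> K \<Longrightarrow> y \<in> alpha_cut v (\<alpha> / 2) \<Longrightarrow> norm y \<le> R"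
    unfolding bounded_iff by blast
  have "norm x \<le> R + \<alpha> / 2" if "u \<in> U" and x: "x \<in> alpha_cut u \<alpha>" for u x
  proof -
    obtain v where v: "v \<in> K" "H_end u v < \<alpha> / 2"
      using near \<open>u \<in> U\<close> by blast
    obtain y where y: "y \<in> alpha_cut v (\<alpha> - \<alpha> / 2)" "dist x y < \<alpha> / 2"
      using alpha_cut_near_point[OF x _ v(2)] assms(3) by auto
    have "norm y \<le> R"
      using R v(1) y(1) by simp
    moreover have "norm x \<le> norm y + dist x y"
      by (simp add: dist_norm norm_triangle_sub)
    ultimately show ?thesis
      using y(2) by linarith
  qed
  then show ?thesis
    unfolding bounded_iff by blast
qed

section \<open>Completeness\<close>

text \<open>The fuzzy set is read off as the height of \<open>L\<close> above each point. Closedness of \<open>L\<close> makes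
  this supremum a member of \<open>L\<close>, and it also gives upper semicontinuity.\<close>

lemma ex_fuzzy_set_with_endograph:
  fixes L :: "('a::metric_space \<times> real) set"
  assumes "closed L"
    and range: "\<And>x t. (x, t) \<in> L \<Longrightarrow> 0 \<le> t \<and> t \<le> 1"
    and base: "\<And>x. (x, 0) \<in> L"
    and down: "\<And>x s t. (x, t) \<in> L \<Longrightarrow> 0 \<le> s \<Longrightarrow> s \<le> t \<Longrightarrow> (x, s) \<in> L"
  obtains u where "upper_semicontinuous (membership u)" "endograph u = L"
proof -
  define f where "f x = Sup {t. (x, t) \<in> L}" for x
  have bdd: "bdd_above {t. (x, t) \<in> L}" for x
    using range by (intro bdd_aboveI[of _ 1]) auto
  have le_f: "t \<le> f x" if "(x, t) \<in> L" for x t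
    unfolding f_def using that bdd by (intro cSup_upper) auto
  have f_in: "(x, f x) \<in> L" for x
  proof -
    have "closed (Pair x -` L)"
      by (intro closed_vimage assms(1) continuous_intros)
    then have "Sup (Pair x -` L) \<in> Pair x -` L"
      using base[of x] bdd[of x] by (intro closed_contains_Sup) (auto simp: vimage_def)
    then show ?thesis
      by (simp add: f_def vimage_def)
  qed
  define u where "u = Fuzzy f"
  have u: "membership u = f"
    unfolding u_def using range[OF f_in] by (intro Fuzzy_inverse) auto
  have L_iff: "(x, t) \<in> L \<longleftrightarrow> 0 \<le> t \<and> t \<le> f x" for x t
    using range le_f down f_in by blast
  have "f x \<le> 1" for x
    using range[OF f_in] by simp
  then have eq: "endograph u = L"
    by (auto simp: endograph_def u L_iff intro: order_trans)
  have "upper_semicontinuous f"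
    unfolding upper_semicontinuous_def
  proof (intro allI impI)
    fix x r assume "f x < r"
    have "closed ((\<lambda>y. (y, r)) -` L)"
      by (intro closed_vimage assms(1) continuous_intros)
    then have "open (- ((\<lambda>y. (y, r)) -` L))"
      by (simp add: open_Compl)
    moreover have "x \<in> - ((\<lambda>y. (y, r)) -` L)"
      using \<open>f x < r\<close> by (simp add: L_iff)
    moreover have "0 \<le> r"
      using \<open>f x < r\<close> range[OF f_in[of x]] by linarith
    then have "f y < r" if "y \<in> - ((\<lambda>y. (y, r)) -` L)" for y
      using that by (simp add: L_iff)
    ultimately show "\<forall>\<^sub>F y in nhds x. f y < r"
      unfolding eventually_nhds by blast
  qed
  then show thesis
    using that u eq by metis
qed

text \<open>Lowering a point of an endograph keeps it inside, so a point near \<open>(x, t)\<close> can be lowered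
  to one near \<open>(x, s)\<close>. This is why limits of endographs are closed downwards.\<close>

lemma infdist_endograph_mono:
  assumes "0 \<le> s" "s \<le> t"
  shows "infdist (x, s) (endograph u) \<le> infdist (x, t) (endograph u)"
  unfolding infdist_notempty[OF endograph_nonempty, of "(x, t)"]
proof (rule cINF_greatest[OF endograph_nonempty])
  fix b assume b: "b \<in> endograph u"
  obtain y r where yr: "b = (y, r)" by (cases b)
  have "(y, min r s) \<in> endograph u"
    using b assms(1) by (auto simp: yr endograph_def)
  moreover have "\<bar>s - min r s\<bar> \<le> \<bar>t - r\<bar>"
    using assms by linarith
  then have "dist (x, s) (y, min r s) \<le> dist (x, t) b"
    unfolding yr dist_Pair_Pair dist_real_def
    by (intro real_sqrt_le_mono add_left_mono power_mono) auto
  ultimately show "infdist (x, s) (endograph u) \<le> dist (x, t) b"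
    by (rule infdist_le2)
qed

lemma infdist_le_infdist_plus_H_end:
  "infdist p (endograph u) \<le> infdist p (endograph v) + H_end v u"
proof -
  have "infdist p (endograph u) - H_end v u \<le> dist p b" if "b \<in> endograph v" for b
    using infdist_le_H_end[OF that, of u] infdist_triangle[of p "endograph u" b] by linarith
  then have "infdist p (endograph u) - H_end v u \<le> infdist p (endograph v)"
    unfolding infdist_notempty[OF endograph_nonempty[of v]]
    by (intro cINF_greatest endograph_nonempty) auto
  then show ?thesis
    by linarith
qed

text \<open>For every point \<open>p\<close> the distances from \<open>p\<close> to the endographs form a Cauchy sequence, so to
  show that they tend to \<open>0\<close> it suffices to make them small at infinitely many indices. The
  limit set \<open>L\<close> collects the points for which they do. A point \<open>a\<close> of a late endograph has
  nearby points in all later ones; these stay bounded, hence accumulate, and every accumulation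
  point is a point of \<open>L\<close> near \<open>a\<close>.\<close>

lemma H_end_Cauchy_limit:
  fixes \<sigma> :: "nat \<Rightarrow> 'a::heine_borel fuzzy_set"
  assumes Cauchy: "\<And>e. e > 0 \<Longrightarrow> \<exists>N. \<forall>m\<ge>N. \<forall>n\<ge>N. H_end (\<sigma> m) (\<sigma> n) < e"
  obtains u where "upper_semicontinuous (membership u)" "(\<lambda>n. H_end (\<sigma> n) u) \<longlonglongrightarrow> 0"
proof -
  define L where "L = {p. (\<lambda>n. infdist p (endograph (\<sigma> n))) \<longlonglongrightarrow> 0}"
  have L_I: "p \<in> L" if freq: "\<And>e N. e > 0 \<Longrightarrow> \<exists>n\<ge>N. infdist p (endograph (\<sigma> n)) < e" for p
    unfolding L_def mem_Collect_eq
  proof (rule LIMSEQ_I)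
    fix e :: real assume "e > 0"
    obtain N where N: "\<And>m n. m \<ge> N \<Longrightarrow> n \<ge> N \<Longrightarrow> H_end (\<sigma> m) (\<sigma> n) < e / 2"
      using Cauchy[of "e / 2"] \<open>e > 0\<close> by auto
    obtain m where m: "m \<ge> N" "infdist p (endograph (\<sigma> m)) < e / 2"
      using freq[of "e / 2" N] \<open>e > 0\<close> by auto
    have "infdist p (endograph (\<sigma> n)) < e" if "n \<ge> N" for n
      using infdist_le_infdist_plus_H_end[of p "\<sigma> n" "\<sigma> m"] m N[OF m(1) that] by linarith
    then show "\<exists>no. \<forall>n\<ge>no. norm (infdist p (endograph (\<sigma> n)) - 0) < e"
      by (auto simp: infdist_nonneg)
  qed
  have L_D: "\<exists>N. \<forall>n\<ge>N. infdist p (endograph (\<sigma> n)) < e" if "p \<in> L" "e > 0" for p e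
    using that LIMSEQ_D[of _ 0 e] by (fastforce simp: L_def infdist_nonneg)
  have "closed L"
    unfolding closed_sequential_limits
  proof (intro allI impI, elim conjE)
    fix f p assume f: "\<forall>n. f n \<in> L" "f \<longlonglongrightarrow> p"
    show "p \<in> L"
    proof (rule L_I)
      fix e :: real and N assume "e > 0"
      then obtain k where k: "dist (f k) p < e / 2"
        using f(2) by (meson half_gt_zero metric_LIMSEQ_D order_refl)
      obtain M where M: "\<And>n. n \<ge> M \<Longrightarrow> infdist (f k) (endograph (\<sigma> n)) < e / 2"
        using L_D[of "f k" "e / 2"] f(1) \<open>e > 0\<close> by auto
      have "infdist p (endograph (\<sigma> (max M N))) < e"
        using infdist_triangle[of p _ "f k"] M[of "max M N"] k
        by (smt (verit) dist_commute field_sum_of_halves max.cobounded1)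
      then show "\<exists>n\<ge>N. infdist p (endograph (\<sigma> n)) < e"
        by (intro exI[of _ "max M N"]) auto
    qed
  qed
  moreover have "0 \<le> t \<and> t \<le> 1" if "(x, t) \<in> L" for x t
  proof -
    have "\<exists>s. 0 \<le> s \<and> s \<le> 1 \<and> dist t s < e" if e: "e > 0" for e
    proof -
      obtain n where "infdist (x, t) (endograph (\<sigma> n)) < e"
        using L_D[OF \<open>(x, t) \<in> L\<close> e] by auto
      then obtain b where b: "b \<in> endograph (\<sigma> n)" "dist (x, t) b < e"
        using infdist_less_obtains endograph_nonempty by blast
      then show ?thesis
        using dist_snd_le[of "(x, t)" b] by (intro exI[of _ "snd b"]) (auto simp: endograph_def)
    qed
    from this[of "- t"] this[of "t - 1"] show ?thesis
      by (force simp: dist_real_def)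
  qed
  moreover have "(x, 0) \<in> L" for x
    by (simp add: L_def zero_in_endograph)
  moreover have "(x, s) \<in> L" if "(x, t) \<in> L" "0 \<le> s" "s \<le> t" for x s t
    using that(1) unfolding L_def mem_Collect_eq
    by (rule tendsto_sandwich[rotated 2, OF tendsto_const])
       (auto simp: infdist_nonneg infdist_endograph_mono that)
  ultimately obtain u where u: "upper_semicontinuous (membership u)" "endograph u = L"
    using ex_fuzzy_set_with_endograph by metis
  have "(\<lambda>n. H_end (\<sigma> n) u) \<longlonglongrightarrow> 0"
  proof (rule LIMSEQ_I)
    fix e :: real assume "e > 0"
    obtain N where N: "\<And>m n. m \<ge> N \<Longrightarrow> n \<ge> N \<Longrightarrow> H_end (\<sigma> m) (\<sigma> n) < e / 2"
      using Cauchy[of "e / 2"] \<open>e > 0\<close> by auto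
    have "H_end (\<sigma> n) u \<le> e / 2" if n: "n \<ge> N" for n
    proof (rule H_end_leI)
      fix a assume a: "a \<in> endograph (\<sigma> n)"
      have "\<exists>b\<in>endograph (\<sigma> (N + k)). dist a b < e / 2" for k
        using endograph_near_point[OF a N[OF n]] by (metis le_add1)
      then obtain b where b: "\<And>k. b k \<in> endograph (\<sigma> (N + k))" "\<And>k. dist a (b k) < e / 2"
        by metis
      have "\<forall>k. b k \<in> cball a (e / 2)"
        using b(2) by (simp add: less_imp_le)
      then obtain q r where q: "q \<in> cball a (e / 2)" and r: "strict_mono r" "(b \<circ> r) \<longlonglongrightarrow> q"
        using compact_cball[of a "e / 2"] unfolding compact_def by metis
      have "q \<in> L"
      proof (rule L_I)
        fix d :: real and M assume "d > 0"
        then obtain K where K: "\<And>k. k \<ge> K \<Longrightarrow> dist ((b \<circ> r) k) q < d"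
          using r(2) by (meson metric_LIMSEQ_D)
        define k where "k = max K M"
        have "k \<le> r k"
          using r(1) by (rule strict_mono_imp_increasing)
        moreover have "infdist q (endograph (\<sigma> (N + r k))) < d"
          using infdist_le[OF b(1), of q "r k"] K[of k] by (simp add: k_def dist_commute)
        ultimately show "\<exists>n\<ge>M. infdist q (endograph (\<sigma> n)) < d"
          by (intro exI[of _ "N + r k"]) (auto simp: k_def)
      qed
      then show "infdist a (endograph u) \<le> e / 2"
        using q unfolding u(2) by (intro infdist_le2[of q]) auto
    next
      fix p assume "p \<in> endograph u"
      then have "p \<in> L"
        by (simp add: u(2))
      show "infdist p (endograph (\<sigma> n)) \<le> e / 2"
      proof (rule field_le_epsilon)
        fix d :: real assume "d > 0"
        obtain M where M: "\<And>m. m \<ge> M \<Longrightarrow> infdist p (endograph (\<sigma> m)) < d"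
          using L_D[OF \<open>p \<in> L\<close> \<open>d > 0\<close>] by auto
        show "infdist p (endograph (\<sigma> n)) \<le> e / 2 + d"
          using infdist_le_infdist_plus_H_end[of p "\<sigma> n" "\<sigma> (max M N)"]
            M[of "max M N"] N[of "max M N" n] n by simp
      qed
    qed
    then show "\<exists>no. \<forall>n\<ge>no. norm (H_end (\<sigma> n) u - 0) < e"
      using \<open>e > 0\<close> by (force simp: H_end_nonneg intro!: exI[of _ N])
  qed
  then show thesis
    using that u(1) by blast
qed

lemma mcomplete_F_USCG:
  "Metric_space.mcomplete (F_USCG :: (real ^ 'm) fuzzy_set set) H_end"
  unfolding USCG.mcomplete_def
proof (intro allI impI)
  fix \<sigma> :: "nat \<Rightarrow> (real ^ 'm) fuzzy_set"
  assume "USCG.MCauchy \<sigma>"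
  then have \<sigma>: "range \<sigma> \<subseteq> F_USCG"
    and Cauchy: "\<And>e. e > 0 \<Longrightarrow> \<exists>N. \<forall>m\<ge>N. \<forall>n\<ge>N. H_end (\<sigma> m) (\<sigma> n) < e"
    unfolding USCG.MCauchy_def by simp_all
  obtain u where u: "upper_semicontinuous (membership u)" "(\<lambda>n. H_end (\<sigma> n) u) \<longlonglongrightarrow> 0"
    using H_end_Cauchy_limit[OF Cauchy] by blast
  have lim: "\<exists>N. \<forall>n\<ge>N. H_end (\<sigma> n) u < e" if "e > 0" for e
    using LIMSEQ_D[OF u(2) that] by (simp add: H_end_nonneg)
  have "bounded (alpha_cut u \<alpha>)" if \<alpha>: "\<alpha> \<in> {0<..1}" for \<alpha>
  proof -
    obtain n where "H_end (\<sigma> n) u < \<alpha> / 2"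
      using lim[of "\<alpha> / 2"] \<alpha> by auto
    then show ?thesis
      using bounded_cuts_of_finite_net[of "{\<sigma> n}" \<alpha> "{u}"] \<sigma> \<alpha>
      by (auto simp: H_end_commute)
  qed
  then have "u \<in> F_USCG"
    using u(1) by (simp add: F_USCG_def)
  moreover have "\<sigma> n \<in> F_USCG" for n
    using \<sigma> by blast
  ultimately have "limitin USCG.mtopology \<sigma> u sequentially"
    by (simp add: USCG.limit_metric_sequentially lim)
  then show "\<exists>u. limitin USCG.mtopology \<sigma> u sequentially" ..
qed

section \<open>Total boundedness\<close>

text \<open>Two fuzzy sets are close as soon as their endographs are near the same points of a finite
  net of the region where members of \<open>U\<close> can exceed height \<open>e\<close>. Only finitely many sets of net
  points exist, so one representative for each of them that occurs suffices.\<close>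

lemma finite_net_of_bounded_cuts:
  fixes U :: "'a::heine_borel fuzzy_set set"
  assumes "e > 0" and bounded: "bounded (\<Union>u\<in>U. alpha_cut u e)"
  obtains K where "finite K" "K \<subseteq> U" "\<And>u. u \<in> U \<Longrightarrow> \<exists>v\<in>K. H_end v u \<le> 2 * e"
proof -
  define C where "C = closure (\<Union>u\<in>U. alpha_cut u e) \<times> {0..1::real}"
  have "compact C"
    unfolding C_def using bounded by (intro compact_Times) auto
  then obtain G where G: "finite G" "C \<subseteq> (\<Union>g\<in>G. ball g e)"
    using \<open>e > 0\<close> unfolding compact_eq_totally_bounded by blast
  define trace where "trace u = {g \<in> G. infdist g (endograph u) < e}" for u :: "'a fuzzy_set"
  have excess: "infdist a (endograph v) \<le> 2 * e"
    if "u \<in> U" and trace: "trace u = trace v" and a: "a \<in> endograph u" for u v a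
  proof -
    obtain x t where xt: "a = (x, t)" by (cases a)
    show ?thesis
    proof (cases "t \<le> e")
      case True
      then have "dist a (x, 0) \<le> 2 * e"
        using a \<open>e > 0\<close> by (auto simp: xt endograph_def dist_Pair_Pair)
      then show ?thesis
        by (rule infdist_le2[OF zero_in_endograph])
    next
      case False
      then have "x \<in> alpha_cut u e"
        using a by (simp add: xt endograph_def alpha_cut_def)
      then have "a \<in> C"
        using a \<open>u \<in> U\<close> closure_subset by (fastforce simp: C_def xt endograph_def)
      then obtain g where g: "g \<in> G" "dist g a < e"
        using G(2) by auto
      then have "g \<in> trace u"
        using infdist_le[OF a, of g] by (simp add: trace_def)
      then have "infdist g (endograph v) < e"
        unfolding trace by (simp add: trace_def)
      then show ?thesis
        using infdist_triangle[of a "endograph v" g] g(2) by (simp add: dist_commute)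
    qed
  qed
  have "trace ` U \<subseteq> Pow G"
    by (auto simp: trace_def)
  then have "finite (trace ` U)"
    using G(1) finite_subset by blast
  then obtain K where K: "K \<subseteq> U" "finite K" "trace ` U = trace ` K"
    using finite_subset_image[of "trace ` U" trace U] by auto
  have "\<exists>v\<in>K. H_end v u \<le> 2 * e" if u: "u \<in> U" for u
  proof -
    obtain v where v: "v \<in> K" "trace u = trace v"
      using K(3) u by (metis imageE image_eqI)
    have "v \<in> U"
      using v(1) K(1) by blast
    then have "H_end v u \<le> 2 * e"
      using excess[OF u v(2)] excess[OF _ v(2)[symmetric]] by (intro H_end_leI) auto
    then show ?thesis
      using v(1) by blast
  qed
  then show thesis
    using that K by blast
qed

lemma mtotally_bounded_iff_bounded_cuts:
  fixes U :: "(real ^ 'm) fuzzy_set set"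
  assumes "U \<subseteq> F_USCG"
  shows "Metric_space.mtotally_bounded F_USCG H_end U \<longleftrightarrow>
           (\<forall>\<alpha>\<in>{0<..1}. bounded (\<Union>u\<in>U. alpha_cut u \<alpha>))"
proof
  assume tb: "USCG.mtotally_bounded U"
  show "\<forall>\<alpha>\<in>{0<..1}. bounded (\<Union>u\<in>U. alpha_cut u \<alpha>)"
  proof
    fix \<alpha> :: real assume \<alpha>: "\<alpha> \<in> {0<..1}"
    then obtain K where K: "finite K" "K \<subseteq> U" "U \<subseteq> (\<Union>v\<in>K. USCG.mball v (\<alpha> / 2))"
      using tb unfolding USCG.mtotally_bounded_def by (metis greaterThanAtMost_iff half_gt_zero)
    have "\<exists>v\<in>K. H_end u v < \<alpha> / 2" if "u \<in> U" for u
      using K(3) that by (fastforce simp: H_end_commute)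
    moreover have "K \<subseteq> F_USCG"
      using K(2) assms by blast
    ultimately show "bounded (\<Union>u\<in>U. alpha_cut u \<alpha>)"
      using bounded_cuts_of_finite_net[OF K(1) _ \<alpha>] by blast
  qed
next
  assume bounded: "\<forall>\<alpha>\<in>{0<..1}. bounded (\<Union>u\<in>U. alpha_cut u \<alpha>)"
  show "USCG.mtotally_bounded U"
    unfolding USCG.mtotally_bounded_def
  proof (intro allI impI)
    fix \<epsilon> :: real assume "\<epsilon> > 0"
    define e where "e = min (\<epsilon> / 3) 1"
    have e: "e > 0" "e \<le> 1" "2 * e < \<epsilon>"
      using \<open>\<epsilon> > 0\<close> by (auto simp: e_def)
    then obtain K where K: "finite K" "K \<subseteq> U" "\<And>u. u \<in> U \<Longrightarrow> \<exists>v\<in>K. H_end v u \<le> 2 * e"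
      using finite_net_of_bounded_cuts[of e U] bounded by auto
    have "U \<subseteq> (\<Union>v\<in>K. USCG.mball v \<epsilon>)"
    proof
      fix u assume "u \<in> U"
      then obtain v where v: "v \<in> K" "H_end v u \<le> 2 * e"
        using K(3) by blast
      then have "u \<in> USCG.mball v \<epsilon>"
        using \<open>u \<in> U\<close> K(2) assms e(3) by (auto)
      then show "u \<in> (\<Union>v\<in>K. USCG.mball v \<epsilon>)"
        using v(1) by blast
    qed
    then show "\<exists>K. finite K \<and> K \<subseteq> U \<and> U \<subseteq> (\<Union>v\<in>K. USCG.mball v \<epsilon>)"
      using K(1,2) by blast
  qed
qed

section \<open>Compactness\<close>

theorem theorem7p2:
  fixes U :: "(real ^ 'm) fuzzy_set set"
  assumes "U \<subseteq> F_USCG"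
  shows "compactin (Metric_space.mtopology F_USCG H_end) U \<longleftrightarrow>
           closedin (Metric_space.mtopology F_USCG H_end) U \<and>
           (\<forall>\<alpha>\<in>{0<..1}. bounded (\<Union>u\<in>U. alpha_cut u \<alpha>))"
proof -
  have "compactin USCG.mtopology U \<longleftrightarrow> closedin USCG.mtopology U \<and> USCG.mtotally_bounded U"
  proof
    assume "compactin USCG.mtopology U"
    then show "closedin USCG.mtopology U \<and> USCG.mtotally_bounded U"
      using compactin_imp_closedin[OF USCG.Hausdorff_space_mtopology]
        USCG.compactin_imp_mtotally_bounded by blast
  next
    assume "closedin USCG.mtopology U \<and> USCG.mtotally_bounded U"
    then show "compactin USCG.mtopology U"
      using USCG.mtotally_bounded_eq_compact_closure_of[OF mcomplete_F_USCG, of U]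
      by (metis closure_of_closedin)
  qed
  then show ?thesis
    by (simp add: mtotally_bounded_iff_bounded_cuts[OF assms])
qed

end
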